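(* For all integers $m,n\geq 2$, $W(T(2m,2n))\geq \max\{3m+n+2,\,3n+m+2\}$. For every integer $m\geq 2$ and every positive integer $n$, the torus $T(2m,2n+1)$ satisfies $$W(T(2m,2n+1))\geq\begin{cases}2m+2n+2,& \text{if } m \text{ is odd},\\ 2m+2n+3,& \text{if } m \text{ is even}.\end{cases}$$
   Context: All graphs are finite, undirected, without loops or multiple edges. An edge-coloring of a graph $G$ with colors $1,\ldots,t$ is an interval $t$-coloring if all $t$ colors are used, and the colors of the edges incident to each vertex are distinct and form an interval of consecutive integers. A graph is interval colorable if it has an interval $t$-coloring for some positive integer $t$; for such a graph, $W(G)$ is the greatest such $t$. The torus $T(a,b)$ is the Cartesian product $C_a\square C_b$ of the cycles on $a$ and $b$ vertices; it is interval colorable whenever $ab$ is even. The Cartesian product $G\square H$ has vertex set $V(G)\times V(H)$, with $(u_1,v_1)(u_2,v_2)$ an edge iff either $u_1=u_2$ and $v_1v_2\in E(H)$, or $v_1=v_2$ and $u_1u_2\in E(G)$. *)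

theory Defs
  imports "Graph_Theory.Pair_Digraph"
begin

text \<open>
  A finite simple graph is a \<^locale>\<open>pair_graph\<close>: a finite, symmetric, loop-free set of arcs,
  where each undirected edge is represented by its two opposite arcs.  Colors are assigned to
  the undirected edges, so that opposite arcs share a color.
\<close>

definition uedges :: "'a pair_pre_digraph \<Rightarrow> 'a set set" where
  "uedges G = {{u, v} | u v. (u, v) \<in> parcs G}"

definition incident_uedges :: "'a pair_pre_digraph \<Rightarrow> 'a \<Rightarrow> 'a set set" where
  "incident_uedges G v = {e \<in> uedges G. v \<in> e}"

definition interval_coloring :: "'a pair_pre_digraph \<Rightarrow> nat \<Rightarrow> ('a set \<Rightarrow> nat) \<Rightarrow> bool" where
  "interval_coloring G t c \<longleftrightarrow>
     c ` uedges G = {1..t} \<and>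
     (\<forall>v \<in> pverts G. inj_on c (incident_uedges G v) \<and>
        (\<exists>a b. c ` incident_uedges G v = {a..b}))"

definition interval_colorable :: "'a pair_pre_digraph \<Rightarrow> bool" where
  "interval_colorable G \<longleftrightarrow> (\<exists>t>0. \<exists>c. interval_coloring G t c)"

text \<open>
  Meaningful only for interval colorable graphs with finitely many edges: the set below is then
  finite (see \<open>interval_coloring_le_card\<close>) and nonempty.
\<close>

definition W :: "'a pair_pre_digraph \<Rightarrow> nat" where
  "W G = Max {t. t > 0 \<and> (\<exists>c. interval_coloring G t c)}"

text \<open>This is the cycle on \<open>n\<close> vertices for \<open>n \<ge> 3\<close>; smaller values of \<open>n\<close> are degenerate.\<close>

definition cycle_graph :: "nat \<Rightarrow> nat pair_pre_digraph" where
  "cycle_graph n =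
     \<lparr>pverts = {0..<n},
      parcs = {(i, j). i < n \<and> j < n \<and> (j = Suc i mod n \<or> i = Suc j mod n)}\<rparr>"

definition cartesian_product ::
    "'a pair_pre_digraph \<Rightarrow> 'b pair_pre_digraph \<Rightarrow> ('a \<times> 'b) pair_pre_digraph" where
  "cartesian_product G H =
     \<lparr>pverts = pverts G \<times> pverts H,
      parcs = {((u1, v1), (u2, v2)) | u1 v1 u2 v2.
        (u1 = u2 \<and> u1 \<in> pverts G \<and> (v1, v2) \<in> parcs H) \<or>
        (v1 = v2 \<and> v1 \<in> pverts H \<and> (u1, u2) \<in> parcs G)}\<rparr>"

definition torus :: "nat \<Rightarrow> nat \<Rightarrow> (nat \<times> nat) pair_pre_digraph" where
  "torus a b = cartesian_product (cycle_graph a) (cycle_graph b)"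

lemma pair_graphI':
  assumes "finite (pverts G)"
    and "\<And>u v. (u, v) \<in> parcs G \<Longrightarrow> u \<in> pverts G \<and> u \<noteq> v \<and> (v, u) \<in> parcs G"
  shows "pair_graph G"
proof -
  have sub: "parcs G \<subseteq> pverts G \<times> pverts G"
  proof
    fix e assume "e \<in> parcs G"
    then show "e \<in> pverts G \<times> pverts G"
      using assms(2)[of "fst e" "snd e"] assms(2)[of "snd e" "fst e"] by (cases e) auto
  qed
  have fin: "finite (parcs G)"
    using finite_subset[OF sub] assms(1) by blast
  show ?thesis
    using assms sub fin by unfold_locales (auto intro!: symI simp: symmetric_def)
qed

lemma pair_graph_cycle_graph:
  assumes "n \<ge> 3"
  shows "pair_graph (cycle_graph n)"
proof (rule pair_graphI')
  have "i \<noteq> Suc i mod n" if "i < n" for i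
    using that assms by (cases "Suc i = n") auto
  note no_fix = this
  show "u \<in> pverts (cycle_graph n) \<and> u \<noteq> v \<and> (v, u) \<in> parcs (cycle_graph n)"
    if "(u, v) \<in> parcs (cycle_graph n)" for u v
    using that no_fix[of u] unfolding cycle_graph_def by auto
qed (simp add: cycle_graph_def)

lemma pair_graph_cartesian_product:
  assumes "pair_graph G" and "pair_graph H"
  shows "pair_graph (cartesian_product G H)"
proof -
  interpret G: pair_graph G by fact
  interpret H: pair_graph H by fact
  show ?thesis
  proof (rule pair_graphI')
    show "finite (pverts (cartesian_product G H))"
      by (simp add: cartesian_product_def)
    fix p q assume "(p, q) \<in> parcs (cartesian_product G H)"
    then show "p \<in> pverts (cartesian_product G H) \<and> p \<noteq> q \<and> (q, p) \<in> parcs (cartesian_product G H)"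
      unfolding cartesian_product_def
      by (auto dest: G.arcs_symmetric H.arcs_symmetric G.in_arcsD1 H.in_arcsD1 G.no_loops' H.no_loops')
  qed
qed

lemma pair_graph_torus: "a \<ge> 3 \<Longrightarrow> b \<ge> 3 \<Longrightarrow> pair_graph (torus a b)"
  by (simp add: torus_def pair_graph_cycle_graph pair_graph_cartesian_product)

lemma (in pair_graph) finite_uedges: "finite (uedges G)"
proof -
  have "uedges G = (\<lambda>(u, v). {u, v}) ` parcs G"
    by (auto simp: uedges_def)
  then show ?thesis by simp
qed

lemma interval_coloring_le_card:
  assumes "finite (uedges G)" and "interval_coloring G t c"
  shows "t \<le> card (uedges G)"
  using card_image_le[OF assms(1), of c] assms(2) by (simp add: interval_coloring_def)

lemma (in pair_graph) W_ge:
  assumes "interval_coloring G t c" and "t > 0"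
  shows "W G \<ge> t"
proof -
  have "{t. t > 0 \<and> (\<exists>c. interval_coloring G t c)} \<subseteq> {..card (uedges G)}"
    using interval_coloring_le_card[OF finite_uedges] by auto
  then have "finite {t. t > 0 \<and> (\<exists>c. interval_coloring G t c)}"
    using finite_subset by blast
  then show ?thesis
    unfolding W_def using assms by (intro Max_ge) auto
qed

end

theory Submission
  imports Defs
begin

text \<open>
  All colorings are given by a color \<open>H i j\<close> of the edge from \<open>(i, j)\<close> to \<open>(i + 1, j)\<close>, a color
  \<open>V i j\<close> of the edge from \<open>(i, j)\<close> to \<open>(i, j + 1)\<close>, and the least color \<open>L i j\<close> at \<open>(i, j)\<close>.
  Since the torus is connected and adjacent vertices share a color, no color between the extreme
  ones is skipped.

  For \<open>T(2m, 2n)\<close>, color every second-coordinate cycle by a shift of the interval coloring of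
  \<open>C\<^bsub>2n\<^esub>\<close> with \<open>n + 1\<close> colors.  The shift grows by 3 with each step from \<open>i = 0\<close> to \<open>i = m\<close> on both
  sides, the two first-coordinate edges at a vertex being the extreme colors there, except that
  both are above the cycle colors at \<open>i = 0\<close> and both below them at \<open>i = m\<close>.

  For \<open>T(2m, 2n + 1)\<close> the least colors in the column \<open>i = 0\<close> are
  \<open>1, 3, 5, \<dots>, 2n + 1, 2n, \<dots>, 4, 2\<close>.
  Two steps in the first coordinate raise all colors by 4, and the \<open>2m\<close> columns are a path of \<open>m\<close>
  columns together with its mirror image.
\<close>

section \<open>Indexing the edges of a torus\<close>

definition cyc_pred :: "nat \<Rightarrow> nat \<Rightarrow> nat" where
  "cyc_pred n i = (if i = 0 then n - 1 else i - 1)"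

lemma cyc_pred_less: "i < n \<Longrightarrow> cyc_pred n i < n"
  by (auto simp: cyc_pred_def)

lemma Suc_mod_if: "i < n \<Longrightarrow> Suc i mod n = (if Suc i = n then 0 else Suc i)"
  by auto

lemma Suc_mod_eq_iff: "i < n \<Longrightarrow> k < n \<Longrightarrow> Suc k mod n = i \<longleftrightarrow> k = cyc_pred n i"
  by (auto simp: Suc_mod_if cyc_pred_def)

lemma Suc_mod_neq: "n \<ge> 2 \<Longrightarrow> i < n \<Longrightarrow> Suc i mod n \<noteq> i"
  by (auto simp: Suc_mod_if)

lemma Suc_Suc_mod_neq:
  assumes "n \<ge> 3" "i < n"
  shows "Suc (Suc i mod n) mod n \<noteq> i"
  using assms Suc_mod_if[of i n] Suc_mod_if[of "Suc i" n] by (cases "Suc i = n") auto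

text \<open>Naming an edge by its tail and direction lets colors be given on indices rather than on
  two-element sets.\<close>

definition torus_edge :: "nat \<Rightarrow> nat \<Rightarrow> bool \<times> nat \<times> nat \<Rightarrow> (nat \<times> nat) set" where
  "torus_edge a b = (\<lambda>(d, i, j). {(i, j), if d then (Suc i mod a, j) else (i, Suc j mod b)})"

lemma uedges_torus:
  "uedges (torus a b) = torus_edge a b ` (UNIV \<times> {..<a} \<times> {..<b})" (is "?l = ?r")
proof
  show "?l \<subseteq> ?r"
  proof
    fix e assume "e \<in> ?l"
    then obtain x y x' y' where e: "e = {(x, y), (x', y')}"
      and "((x, y), (x', y')) \<in> parcs (torus a b)"
      by (auto simp: uedges_def)
    then have "x < a \<and> y < b \<and> x' < a \<and> y' < b \<and>
        (x = x' \<and> (y' = Suc y mod b \<or> y = Suc y' mod b) \<or>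
         y = y' \<and> (x' = Suc x mod a \<or> x = Suc x' mod a))"
      by (auto simp: torus_def cartesian_product_def cycle_graph_def)
    then consider "e = torus_edge a b (False, x, y)" "x < a" "y < b"
      | "e = torus_edge a b (False, x', y')" "x' < a" "y' < b"
      | "e = torus_edge a b (True, x, y)" "x < a" "y < b"
      | "e = torus_edge a b (True, x', y')" "x' < a" "y' < b"
      by (auto simp: e torus_edge_def insert_commute)
    then show "e \<in> ?r" by cases auto
  qed
  show "?r \<subseteq> ?l"
    by (fastforce simp: uedges_def torus_edge_def torus_def cartesian_product_def cycle_graph_def)
qed

text \<open>On a cycle of length 2 the forward edges of both vertices would coincide; from length 3
  on, two forward steps never return to the start, so an edge determines its tail.\<close>

lemma inj_on_torus_edge:
  assumes "a \<ge> 3" "b \<ge> 3"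
  shows "inj_on (torus_edge a b) (UNIV \<times> {..<a} \<times> {..<b})"
proof (rule inj_onI)
  fix x y
  assume "x \<in> UNIV \<times> {..<a} \<times> {..<b}" "y \<in> UNIV \<times> {..<a} \<times> {..<b}"
    and "torus_edge a b x = torus_edge a b y"
  then obtain d i j d' i' j' where xy: "x = (d, i, j)" "y = (d', i', j')"
    and lt: "i < a" "j < b" "i' < a" "j' < b"
    and eq: "torus_edge a b (d, i, j) = torus_edge a b (d', i', j')"
    by (cases x; cases y) auto
  note ne = Suc_mod_neq[of a i] Suc_mod_neq[of b j] Suc_mod_neq[of a i'] Suc_mod_neq[of b j']
    Suc_Suc_mod_neq[of a i] Suc_Suc_mod_neq[of b j] Suc_Suc_mod_neq[of a i'] Suc_Suc_mod_neq[of b j']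
  show "x = y"
    unfolding xy using eq ne lt assms
    by (cases d; cases d') (auto simp: torus_edge_def doubleton_eq_iff)
qed

lemma incident_uedges_torus:
  assumes "i < a" "j < b"
  shows "incident_uedges (torus a b) (i, j) =
    torus_edge a b ` {(True, cyc_pred a i, j), (True, i, j), (False, i, cyc_pred b j), (False, i, j)}"
proof -
  have "(i, j) \<in> torus_edge a b (d, k, l) \<longleftrightarrow>
      (d, k, l) \<in> {(True, cyc_pred a i, j), (True, i, j), (False, i, cyc_pred b j), (False, i, j)}"
    if "k < a" "l < b" for d k l
    using that assms Suc_mod_eq_iff[of i a k] Suc_mod_eq_iff[of j b l]
    by (cases d) (auto simp: torus_edge_def)
  then have "{x \<in> UNIV \<times> {..<a} \<times> {..<b}. (i, j) \<in> torus_edge a b x} =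
      {(True, cyc_pred a i, j), (True, i, j), (False, i, cyc_pred b j), (False, i, j)}"
    using assms cyc_pred_less by auto
  moreover have "incident_uedges (torus a b) (i, j) =
      torus_edge a b ` {x \<in> UNIV \<times> {..<a} \<times> {..<b}. (i, j) \<in> torus_edge a b x}"
    unfolding incident_uedges_def uedges_torus by blast
  ultimately show ?thesis by simp
qed

section \<open>From local conditions to an interval coloring\<close>

locale torus_coloring =
  fixes a b t :: nat and H V L :: "nat \<Rightarrow> nat \<Rightarrow> nat"
  assumes a3: "a \<ge> 3" and b3: "b \<ge> 3"
    and star: "\<And>i j. i < a \<Longrightarrow> j < b \<Longrightarrow>
      {H (cyc_pred a i) j, H i j, V i (cyc_pred b j), V i j} = {L i j..L i j + 3}"
    and L_ge: "\<And>i j. i < a \<Longrightarrow> j < b \<Longrightarrow> 1 \<le> L i j"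
    and L_le: "\<And>i j. i < a \<Longrightarrow> j < b \<Longrightarrow> L i j + 3 \<le> t"
    and least: "\<exists>i<a. \<exists>j<b. L i j = 1"
    and greatest: "\<exists>i<a. \<exists>j<b. L i j + 3 = t"
begin

text \<open>This yields the second term of the maximum for two even cycles.\<close>

lemma transpose: "torus_coloring b a t (\<lambda>i j. V j i) (\<lambda>i j. H j i) (\<lambda>i j. L j i)"
proof
  show "{V j (cyc_pred b i), V j i, H (cyc_pred a j) i, H j i} = {L j i..L j i + 3}"
    if "i < b" "j < a" for i j
    using star[OF that(2,1)] by auto
qed (use a3 b3 L_ge L_le least greatest in auto)

lemma color_attained:
  assumes "1 \<le> k" "k \<le> t"
  shows "\<exists>i<a. \<exists>j<b. k = H i j \<or> k = V i j"
proof (rule ccontr)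
  assume unused: "\<not> ?thesis"
  have skip: "k \<notin> {L i j..L i j + 3}" if "i < a" "j < b" for i j
    using unused star[OF that] that cyc_pred_less[OF that(1)] cyc_pred_less[OF that(2)] by blast
  have H_step: "k < L (Suc i) j \<longleftrightarrow> k < L i j" if "Suc i < a" "j < b" for i j
  proof -
    have "H i j \<in> {L i j..L i j + 3}" "H i j \<in> {L (Suc i) j..L (Suc i) j + 3}"
      using star[of i j] star[of "Suc i" j] that by (auto simp: cyc_pred_def)
    then show ?thesis
      using skip[of i j] skip[of "Suc i" j] that by auto
  qed
  have V_step: "k < L i (Suc j) \<longleftrightarrow> k < L i j" if "i < a" "Suc j < b" for i j
  proof -
    have "V i j \<in> {L i j..L i j + 3}" "V i j \<in> {L i (Suc j)..L i (Suc j) + 3}"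
      using star[of i j] star[of i "Suc j"] that by (auto simp: cyc_pred_def)
    then show ?thesis
      using skip[of i j] skip[of i "Suc j"] that by auto
  qed
  have V_all: "k < L i j \<longleftrightarrow> k < L i 0" if "i < a" "j < b" for i j
    using that by (induction j) (auto simp: V_step)
  have H_all: "k < L i 0 \<longleftrightarrow> k < L 0 0" if "i < a" for i
    using that b3 by (induction i) (auto simp: H_step)
  have all: "k < L i j \<longleftrightarrow> k < L 0 0" if "i < a" "j < b" for i j
    using V_all[OF that] H_all[OF that(1)] by simp
  obtain i j where "i < a" "j < b" "L i j = 1" using least by blast
  then have "\<not> k < L 0 0" using all[of i j] assms by simp
  moreover obtain i' j' where "i' < a" "j' < b" "L i' j' + 3 = t" using greatest by blast
  then have "k < L 0 0" using all[of i' j'] skip[of i' j'] assms by auto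
  ultimately show False by simp
qed

lemma color_bounds:
  assumes "i < a" "j < b"
  shows "H i j \<in> {1..t}" "V i j \<in> {1..t}"
proof -
  have "H i j \<in> {L i j..L i j + 3}" "V i j \<in> {L i j..L i j + 3}"
    using star[OF assms] by auto
  then show "H i j \<in> {1..t}" "V i j \<in> {1..t}"
    using L_ge[OF assms] L_le[OF assms] by auto
qed

lemma interval_coloring_torus: "\<exists>c. interval_coloring (torus a b) t c"
proof -
  let ?D = "UNIV \<times> {..<a} \<times> {..<b}"
  define col where "col = (\<lambda>(d, i, j). if d then H i j else V i j)"
  \<comment> \<open>A color of an edge as a set is read off its unique index.\<close>
  define c where "c = col \<circ> inv_into ?D (torus_edge a b)"
  have c_edge: "c (torus_edge a b x) = col x" if "x \<in> ?D" for x
    using inv_into_f_f[OF inj_on_torus_edge[OF a3 b3] that] by (simp add: c_def)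
  have "c ` uedges (torus a b) = col ` ?D"
    unfolding uedges_torus image_image by (intro image_cong refl c_edge)
  also have "\<dots> = {1..t}"
  proof
    show "col ` ?D \<subseteq> {1..t}" using color_bounds by (auto simp: col_def)
    show "{1..t} \<subseteq> col ` ?D"
    proof
      fix k assume "k \<in> {1..t}"
      then obtain i j where "i < a" "j < b" "k = H i j \<or> k = V i j"
        using color_attained[of k] by auto
      then have "k = col (True, i, j) \<or> k = col (False, i, j)" by (simp add: col_def)
      then show "k \<in> col ` ?D" using \<open>i < a\<close> \<open>j < b\<close> by blast
    qed
  qed
  finally have onto: "c ` uedges (torus a b) = {1..t}" .
  have "inj_on c (incident_uedges (torus a b) v) \<and>
      (\<exists>x y. c ` incident_uedges (torus a b) v = {x..y})"
    if v: "v \<in> pverts (torus a b)" for v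
  proof -
    obtain i j where ij: "v = (i, j)" "i < a" "j < b"
      using v by (auto simp: torus_def cartesian_product_def cycle_graph_def)
    let ?S = "{(True, cyc_pred a i, j), (True, i, j), (False, i, cyc_pred b j), (False, i, j)}"
    have inc: "incident_uedges (torus a b) v = torus_edge a b ` ?S"
      using incident_uedges_torus ij by simp
    have "c ` incident_uedges (torus a b) v = col ` ?S"
      unfolding inc image_image using ij by (intro image_cong refl c_edge) (auto simp: cyc_pred_less)
    also have "\<dots> = {L i j..L i j + 3}"
      using star[OF ij(2,3)] by (simp add: col_def)
    finally have img: "c ` incident_uedges (torus a b) v = {L i j..L i j + 3}" .
    \<comment> \<open>At most four edges carry exactly four colors, so the colors are
      distinct.\<close>
    have "card (incident_uedges (torus a b) v) \<le> card ?S"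
      unfolding inc by (intro card_image_le) simp
    also have "\<dots> \<le> 4"
      by (simp add: card_insert_if)
    finally have "card (incident_uedges (torus a b) v) \<le> card (c ` incident_uedges (torus a b) v)"
      by (simp add: img)
    moreover have fin: "finite (incident_uedges (torus a b) v)" unfolding inc by simp
    ultimately have "inj_on c (incident_uedges (torus a b) v)"
      by (intro eq_card_imp_inj_on) (auto intro: antisym card_image_le)
    then show ?thesis using img by blast
  qed
  with onto show ?thesis unfolding interval_coloring_def by blast
qed

lemma W_torus_ge: "interval_colorable (torus a b) \<and> t \<le> W (torus a b)"
proof -
  interpret pair_graph "torus a b" by (rule pair_graph_torus[OF a3 b3])
  obtain c where "interval_coloring (torus a b) t c" using interval_coloring_torus by blast
  moreover have "t > 0" using greatest by auto
  ultimately show ?thesis using W_ge by (auto simp: interval_colorable_def)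
qed

end

section \<open>Folding even cycles, and the torus of two even cycles\<close>

text \<open>
  \<open>mirror_vertex n\<close> folds the cycle of length \<open>2n\<close> onto a path of \<open>n\<close> vertices; the edge from \<open>i\<close>
  to \<open>i + 1\<close> becomes edge \<open>mirror_edge n i\<close> of the path extended by a half-edge at either end.
\<close>

definition mirror_vertex :: "nat \<Rightarrow> nat \<Rightarrow> nat" where
  "mirror_vertex n i = (if i < n then i else 2 * n - 1 - i)"

definition mirror_edge :: "nat \<Rightarrow> nat \<Rightarrow> nat" where
  "mirror_edge n i = (if i < n then i + 1 else 2 * n - 1 - i)"

text \<open>Folding preserves incidence: the two edges at a vertex become the two path edges or
  half-edges at its image, with their order reversed on the returning half.\<close>

lemma mirror_edges_at:
  assumes "i < 2 * n"
  obtains "mirror_edge n (cyc_pred (2 * n) i) = mirror_vertex n i"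
      "mirror_edge n i = Suc (mirror_vertex n i)"
  | "mirror_edge n i = mirror_vertex n i"
      "mirror_edge n (cyc_pred (2 * n) i) = Suc (mirror_vertex n i)"
proof (cases "i < n")
  case True
  then show ?thesis
    by (intro that(1)) (auto simp: mirror_edge_def mirror_vertex_def cyc_pred_def)
next
  case False
  then show ?thesis using assms
    by (intro that(2)) (auto simp: mirror_edge_def mirror_vertex_def cyc_pred_def)
qed

lemma mirror_vertex_less: "i < 2 * n \<Longrightarrow> mirror_vertex n i < n"
  by (auto simp: mirror_vertex_def)

text \<open>
  On a cycle with lowest vertex \<open>0\<close> and highest vertex \<open>m\<close>, the offset within the interval at \<open>i\<close> of
  the least color not used by the two cycle edges at \<open>i\<close>.
\<close>

definition bump :: "nat \<Rightarrow> nat \<Rightarrow> nat" where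
  "bump m i = (if i = 0 then 0 else if i = m then 2 else 1)"

text \<open>The \<open>- 1\<close> on the returning side, here and in \<open>steep_edge\<close>,
  separates the two cycle edges at the turning points: their colors are 3 and 2 at \<open>0\<close>,
  and \<open>3 * m\<close> and \<open>3 * m - 1\<close> at \<open>m\<close>.\<close>

definition steep_level :: "nat \<Rightarrow> nat \<Rightarrow> nat" where
  "steep_level m i = (if i < m then 3 * i else 3 * (2 * m - i) - 1)"

definition steep_edge :: "nat \<Rightarrow> nat \<Rightarrow> nat" where
  "steep_edge m i = (if i < m then 3 * i + 3 else 3 * (2 * m - i) - 1)"

lemma steep_star:
  assumes "m > 0" "i < 2 * m"
  shows "{steep_edge m (cyc_pred (2 * m) i), steep_edge m i,
      steep_level m i + bump m i, steep_level m i + bump m i + 1} =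
    {steep_level m i..steep_level m i + 3}"
proof -
  consider "i = 0" | "0 < i" "i < m" | "i = m" | "m < i" by linarith
  then show ?thesis
  proof cases
    case 4
    \<comment> \<open>This turns truncated subtraction into addition.\<close>
    then obtain k where "2 * m = i + Suc k" using assms(2) less_imp_Suc_add by fastforce
    then show ?thesis using 4 assms
      by (auto simp: steep_level_def steep_edge_def cyc_pred_def bump_def)
  qed (use assms in \<open>auto simp: steep_level_def steep_edge_def cyc_pred_def bump_def\<close>)
qed

text \<open>The two coordinates contribute additively. The edges in the second coordinate at
  \<open>j\<close> contribute \<open>mirror_vertex n j\<close> and its successor, filling the two
  adjacent places left free by the steep edges.\<close>

lemma torus_coloring_even:
  assumes "m \<ge> 2" "n \<ge> 2"
  shows "torus_coloring (2 * m) (2 * n) (3 * m + n + 2)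
    (\<lambda>i j. steep_edge m i + mirror_vertex n j + 1)
    (\<lambda>i j. steep_level m i + bump m i + mirror_edge n j + 1)
    (\<lambda>i j. steep_level m i + mirror_vertex n j + 1)"
proof
  fix i j assume ij: "i < 2 * m" "j < 2 * n"
  have m: "m > 0" using assms by simp
  define s where "s = mirror_vertex n j + 1"
  have "{steep_edge m (cyc_pred (2 * m) i) + s, steep_edge m i + s,
      steep_level m i + bump m i + s, steep_level m i + bump m i + 1 + s} =
      (\<lambda>x. x + s) ` {steep_level m i..steep_level m i + 3}"
    unfolding steep_star[OF m ij(1), symmetric] by simp
  also have "\<dots> = {steep_level m i + s..steep_level m i + s + 3}"
    by (simp add: add_ac)
  finally have star: "{steep_edge m (cyc_pred (2 * m) i) + s, steep_edge m i + s,
      steep_level m i + bump m i + s, steep_level m i + bump m i + 1 + s} =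
      {steep_level m i + s..steep_level m i + s + 3}" .
  show "{steep_edge m (cyc_pred (2 * m) i) + mirror_vertex n j + 1,
      steep_edge m i + mirror_vertex n j + 1,
      steep_level m i + bump m i + mirror_edge n (cyc_pred (2 * n) j) + 1,
      steep_level m i + bump m i + mirror_edge n j + 1} =
      {steep_level m i + mirror_vertex n j + 1..steep_level m i + mirror_vertex n j + 1 + 3}"
    using ij(2) by (rule mirror_edges_at) (use star in \<open>auto simp: s_def insert_commute\<close>)
  show "steep_level m i + mirror_vertex n j + 1 + 3 \<le> 3 * m + n + 2"
    using mirror_vertex_less[OF ij(2)] assms by (auto simp: steep_level_def)
next
  show "\<exists>i<2 * m. \<exists>j<2 * n. steep_level m i + mirror_vertex n j + 1 = 1"
    using assms by (intro exI[of _ 0] conjI) (auto simp: steep_level_def mirror_vertex_def)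
  show "\<exists>i<2 * m. \<exists>j<2 * n. steep_level m i + mirror_vertex n j + 1 + 3 = 3 * m + n + 2"
    using assms
    by (intro exI[of _ m] exI[of _ "n - 1"] conjI) (auto simp: steep_level_def mirror_vertex_def)
qed (use assms in auto)

section \<open>The torus of an even and an odd cycle\<close>

definition odd_level :: "nat \<Rightarrow> nat \<Rightarrow> nat" where
  "odd_level n j = (if j \<le> n then 2 * j + 1 else 2 * (2 * n + 1 - j))"

definition odd_edge :: "nat \<Rightarrow> nat \<Rightarrow> nat" where
  "odd_edge n j = (if j < n then 2 * j + 3 else 2 * (2 * n + 1 - j))"

text \<open>This colors the edge between columns \<open>k - 1\<close> and \<open>k\<close> of the
  folded path; the two extreme rungs join the path to its mirror image.\<close>

definition rung :: "nat \<Rightarrow> nat \<Rightarrow> nat \<Rightarrow> nat" where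
  "rung n k j = 4 * (k div 2) + odd_level n j + (if even k then bump n j else 3)"

text \<open>The cases are lowest vertex, ascent, highest vertex and descent. In each, the two cycle
  edges and the \<open>bump\<close> fill the offsets 0, 1 and 2.\<close>

lemma odd_edges_at:
  assumes "n > 0" "j < 2 * n + 1"
  obtains "odd_edge n (cyc_pred (2 * n + 1) j) = odd_level n j + 1"
      "odd_edge n j = odd_level n j + 2" "bump n j = 0"
  | "odd_edge n (cyc_pred (2 * n + 1) j) = odd_level n j"
      "odd_edge n j = odd_level n j + 2" "bump n j = 1"
  | "odd_edge n (cyc_pred (2 * n + 1) j) = odd_level n j"
      "odd_edge n j = odd_level n j + 1" "bump n j = 2"
  | "odd_edge n (cyc_pred (2 * n + 1) j) = odd_level n j + 2"
      "odd_edge n j = odd_level n j" "bump n j = 1"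
proof -
  consider "j = 0" | "0 < j" "j < n" | "j = n" | "n < j" by linarith
  then show ?thesis
  proof cases
    case 1
    show ?thesis
      by (rule that(1))
        (use 1 assms in \<open>auto simp: odd_level_def odd_edge_def cyc_pred_def bump_def\<close>)
  next
    case 2
    show ?thesis
      by (rule that(2))
        (use 2 assms in \<open>auto simp: odd_level_def odd_edge_def cyc_pred_def bump_def\<close>)
  next
    case 3
    show ?thesis
      by (rule that(3))
        (use 3 assms in \<open>auto simp: odd_level_def odd_edge_def cyc_pred_def bump_def\<close>)
  next
    case 4
    show ?thesis
      by (rule that(4))
        (use 4 assms in \<open>auto simp: odd_level_def odd_edge_def cyc_pred_def bump_def\<close>)
  qed
qed

text \<open>Offset 3 completes the offsets 0, 1, 2 from above. After the cycle edges and the bump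
  color are raised by 4, the same color completes them from below, so neighboring columns can share
  it.\<close>

lemma odd_star:
  assumes "n > 0" "j < 2 * n + 1"
  shows "{odd_edge n (cyc_pred (2 * n + 1) j), odd_edge n j,
      odd_level n j + bump n j, odd_level n j + 3} = {odd_level n j..odd_level n j + 3}"
    and "{odd_edge n (cyc_pred (2 * n + 1) j) + 4, odd_edge n j + 4,
      odd_level n j + 3, odd_level n j + bump n j + 4} = {odd_level n j + 3..odd_level n j + 6}"
proof -
  have l3: "{l..l + 3} = {l, l + 1, l + 2, l + 3}" for l :: nat by auto
  show "{odd_edge n (cyc_pred (2 * n + 1) j), odd_edge n j,
      odd_level n j + bump n j, odd_level n j + 3} = {odd_level n j..odd_level n j + 3}"
    using assms by (rule odd_edges_at) (simp_all add: l3 insert_commute)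
  have l6: "{l + 3..l + 6} = {l + 3, l + 4, l + 5, l + 6}" for l :: nat by auto
  show "{odd_edge n (cyc_pred (2 * n + 1) j) + 4, odd_edge n j + 4,
      odd_level n j + 3, odd_level n j + bump n j + 4} = {odd_level n j + 3..odd_level n j + 6}"
    using assms by (rule odd_edges_at) (simp_all add: l6 insert_commute add.commute[of "numeral _" "odd_level n j"])
qed

text \<open>From column to column the least color rises alternately by 3 and by 1, whence
  \<open>2 * k + k mod 2\<close>.\<close>

lemma rung_star:
  fixes n j k :: nat
  assumes "n > 0" "j < 2 * n + 1"
  defines "l \<equiv> odd_level n j + 2 * k + k mod 2"
  shows "{rung n k j, rung n (Suc k) j,
      odd_edge n (cyc_pred (2 * n + 1) j) + 4 * (Suc k div 2), odd_edge n j + 4 * (Suc k div 2)} =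
    {l..l + 3}"
proof -
  have shift: "(\<lambda>x. x + 4 * (k div 2)) ` {u..v} = {u + 4 * (k div 2)..v + 4 * (k div 2)}"
    for u v :: nat
    by simp
  show ?thesis
  proof (cases "even k")
    case True
    have "{l..l + 3} = (\<lambda>x. x + 4 * (k div 2)) ` {odd_level n j..odd_level n j + 3}"
      using True unfolding shift by (auto simp: l_def elim!: evenE)
    then show ?thesis
      using True unfolding odd_star(1)[OF assms(1,2), symmetric]
      by (simp add: rung_def insert_commute add_ac)
  next
    case False
    then have k: "l = odd_level n j + 3 + 4 * (k div 2)" "Suc k div 2 = k div 2 + 1"
      by (auto simp: l_def elim!: oddE)
    have "{l..l + 3} = (\<lambda>x. x + 4 * (k div 2)) ` {odd_level n j + 3..odd_level n j + 6}"
      unfolding shift by (simp add: k(1) add_ac)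
    then show ?thesis
      using False k(2) unfolding odd_star(2)[OF assms(1,2), symmetric]
      by (simp add: rung_def insert_commute add_ac)
  qed
qed

lemma torus_coloring_odd:
  assumes "m \<ge> 2" "n \<ge> 1"
  shows "torus_coloring (2 * m) (2 * n + 1)
    (if odd m then 2 * m + 2 * n + 2 else 2 * m + 2 * n + 3)
    (\<lambda>i j. rung n (mirror_edge m i) j)
    (\<lambda>i j. odd_edge n j + 4 * (Suc (mirror_vertex m i) div 2))
    (\<lambda>i j. odd_level n j + 2 * mirror_vertex m i + mirror_vertex m i mod 2)"
proof
  fix i j assume ij: "i < 2 * m" "j < 2 * n + 1"
  let ?k = "mirror_vertex m i"
  let ?l = "odd_level n j + 2 * ?k + ?k mod 2"
  show "{rung n (mirror_edge m (cyc_pred (2 * m) i)) j, rung n (mirror_edge m i) j,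
      odd_edge n (cyc_pred (2 * n + 1) j) + 4 * (Suc ?k div 2),
      odd_edge n j + 4 * (Suc ?k div 2)} = {?l..?l + 3}"
    using rung_star[of n j ?k] assms ij
    by (cases rule: mirror_edges_at[OF ij(1)]) (auto simp: insert_commute)
  show "1 \<le> ?l" using ij by (auto simp: odd_level_def)
  \<comment> \<open>The last column \<open>m - 1\<close> is extreme. Its index is odd exactly when
    \<open>m\<close> is even, which gains the extra color in that case.\<close>
  have bound: "2 * k + k mod 2 + (if odd m then 2 else 1) \<le> 2 * m" if "k < m" for k
  proof (cases "m = Suc k")
    case True
    then show ?thesis by (simp add: mod2_eq_if)
  next
    case False
    then have "k + 2 \<le> m" using that by simp
    moreover have "k mod 2 \<le> 1" by simp
    ultimately show ?thesis by auto
  qed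
  have "odd_level n j \<le> 2 * n + 1" by (auto simp: odd_level_def)
  moreover have "2 * ?k + ?k mod 2 + (if odd m then 2 else 1) \<le> 2 * m"
    using bound mirror_vertex_less[OF ij(1)] by blast
  ultimately show "?l + 3 \<le> (if odd m then 2 * m + 2 * n + 2 else 2 * m + 2 * n + 3)"
    by (auto split: if_splits)
next
  show "\<exists>i<2 * m. \<exists>j<2 * n + 1. odd_level n j + 2 * mirror_vertex m i +
      mirror_vertex m i mod 2 = 1"
    using assms by (intro exI[of _ 0] conjI) (auto simp: odd_level_def mirror_vertex_def)
  have "2 * (m - 1) + (m - 1) mod 2 + (if odd m then 2 else 1) = 2 * m"
    using assms by (cases m) (auto simp: mod2_eq_if)
  then show "\<exists>i<2 * m. \<exists>j<2 * n + 1. odd_level n j + 2 * mirror_vertex m i +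
      mirror_vertex m i mod 2 + 3 = (if odd m then 2 * m + 2 * n + 2 else 2 * m + 2 * n + 3)"
    using assms
    by (intro exI[of _ "m - 1"] exI[of _ n] conjI) (auto simp: odd_level_def mirror_vertex_def)
qed (use assms in auto)

theorem theorem18:
  shows "(\<forall>m n :: nat. m \<ge> 2 \<longrightarrow> n \<ge> 2 \<longrightarrow>
            interval_colorable (torus (2 * m) (2 * n)) \<and>
            W (torus (2 * m) (2 * n)) \<ge> max (3 * m + n + 2) (3 * n + m + 2)) \<and>
         (\<forall>m n :: nat. m \<ge> 2 \<longrightarrow> n \<ge> 1 \<longrightarrow>
            interval_colorable (torus (2 * m) (2 * n + 1)) \<and>
            W (torus (2 * m) (2 * n + 1)) \<ge>
              (if odd m then 2 * m + 2 * n + 2 else 2 * m + 2 * n + 3))"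
proof (intro conjI allI impI)
  fix m n :: nat assume mn: "m \<ge> 2" "n \<ge> 2"
  note A = torus_coloring.W_torus_ge[OF torus_coloring_even[OF mn]]
  \<comment> \<open>The coloring with the roles of \<open>m\<close> and \<open>n\<close> exchanged,
    transposed back.\<close>
  note B = torus_coloring.W_torus_ge[OF torus_coloring.transpose[OF torus_coloring_even[OF mn(2,1)]]]
  show "interval_colorable (torus (2 * m) (2 * n))" using A by blast
  show "W (torus (2 * m) (2 * n)) \<ge> max (3 * m + n + 2) (3 * n + m + 2)"
    using A B by (intro max.boundedI) blast+
next
  fix m n :: nat assume mn: "m \<ge> 2" "n \<ge> 1"
  note C = torus_coloring.W_torus_ge[OF torus_coloring_odd[OF mn]]
  show "interval_colorable (torus (2 * m) (2 * n + 1))" using C by blast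
  show "W (torus (2 * m) (2 * n + 1)) \<ge> (if odd m then 2 * m + 2 * n + 2 else 2 * m + 2 * n + 3)"
    using C by blast
qed

end
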